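(* For every (non-degenerate) triangle $T=(P_1,P_2,P_3)$ in the Euclidean plane there is a unique ellipse $E_9$ such that $T$ is a billiard 3-periodic of $E_9$. Moreover, the center of $E_9$ is the Mittenpunkt of $T$.
   Context: An ellipse (circles allowed) is regarded as a billiard table with elastic reflection at the boundary. A triangle $T$ is a (billiard) 3-periodic of an ellipse $E$ if its three vertices lie on $E$ and at each vertex the normal line to $E$ is the internal angle bisector of $T$ at that vertex. The Mittenpunkt $X_9$ of a triangle is the point where the three lines, each drawn from an excenter through the midpoint of the corresponding side (the side to which that excircle is internally tangent), concur; its trilinear coordinates are $s_2+s_3-s_1 : s_3+s_1-s_2 : s_1+s_2-s_3$, where $s_1,s_2,s_3$ are the sidelengths. *)

theory Defs
  imports "HOL-Analysis.Analysis"
begin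

definition ellipse_centered_at :: "(real^2) set \<Rightarrow> real^2 \<Rightarrow> bool" where
  "ellipse_centered_at E c \<longleftrightarrow>
     (\<exists>u v a b. norm u = 1 \<and> norm v = 1 \<and> u \<bullet> v = 0 \<and> 0 < a \<and> 0 < b \<and>
        E = {x. (((x - c) \<bullet> u) / a)\<^sup>2 + (((x - c) \<bullet> v) / b)\<^sup>2 = 1})"

definition is_ellipse :: "(real^2) set \<Rightarrow> bool" where
  "is_ellipse E \<longleftrightarrow> (\<exists>c. ellipse_centered_at E c)"

definition ellipse_center :: "(real^2) set \<Rightarrow> real^2" where
  "ellipse_center E = (THE c. ellipse_centered_at E c)"

text \<open>Velocities at \<open>p\<close> of curves that stay in \<open>E\<close>; for an ellipse these form the direction
  space of its tangent line at \<open>p\<close>.\<close>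

definition tangent_vectors :: "(real^2) set \<Rightarrow> real^2 \<Rightarrow> (real^2) set" where
  "tangent_vectors E p =
     {w. \<exists>g :: real \<Rightarrow> real^2. (\<forall>t. g t \<in> E) \<and> g 0 = p \<and> (g has_vector_derivative w) (at 0)}"

definition normal_line :: "(real^2) set \<Rightarrow> real^2 \<Rightarrow> (real^2) set" where
  "normal_line E p = {x. \<forall>w \<in> tangent_vectors E p. (x - p) \<bullet> w = 0}"

definition vec_angle :: "real^2 \<Rightarrow> real^2 \<Rightarrow> real" where
  "vec_angle x y = arccos ((x \<bullet> y) / (norm x * norm y))"

text \<open>\<open>L\<close> is the internal bisector at \<open>Q\<close> of the triangle \<open>P Q R\<close>.  It is internal because it
  passes through a point \<open>X\<close> strictly between \<open>P\<close> and \<open>R\<close>.\<close>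

definition internal_angle_bisector ::
    "(real^2) set \<Rightarrow> real^2 \<Rightarrow> real^2 \<Rightarrow> real^2 \<Rightarrow> bool" where
  "internal_angle_bisector L P Q R \<longleftrightarrow>
     (\<exists>X \<in> open_segment P R.
        vec_angle (P - Q) (X - Q) = vec_angle (X - Q) (R - Q) \<and> L = affine hull {Q, X})"

definition billiard_3_periodic ::
    "(real^2) set \<Rightarrow> real^2 \<Rightarrow> real^2 \<Rightarrow> real^2 \<Rightarrow> bool" where
  "billiard_3_periodic E P Q R \<longleftrightarrow>
     P \<in> E \<and> Q \<in> E \<and> R \<in> E \<and>
     internal_angle_bisector (normal_line E P) R P Q \<and>
     internal_angle_bisector (normal_line E Q) P Q R \<and>
     internal_angle_bisector (normal_line E R) Q R P"

text \<open>The excenter opposite the first vertex \<open>P\<close>: the center of the circle that touches the side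
  \<open>Q R\<close> in its interior and the other two side lines outside the sides themselves.  This excludes
  the incircle and the other two excircles.\<close>

definition is_excenter :: "real^2 \<Rightarrow> real^2 \<Rightarrow> real^2 \<Rightarrow> real^2 \<Rightarrow> bool" where
  "is_excenter P Q R J \<longleftrightarrow>
     (\<exists>r > 0.
        (\<exists>D \<in> open_segment Q R. sphere J r \<inter> affine hull {Q, R} = {D}) \<and>
        (\<exists>D. D \<notin> closed_segment R P \<and> sphere J r \<inter> affine hull {R, P} = {D}) \<and>
        (\<exists>D. D \<notin> closed_segment P Q \<and> sphere J r \<inter> affine hull {P, Q} = {D}))"

definition excenter :: "real^2 \<Rightarrow> real^2 \<Rightarrow> real^2 \<Rightarrow> real^2" where
  "excenter P Q R = (THE J. is_excenter P Q R J)"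

definition mittenpunkt :: "real^2 \<Rightarrow> real^2 \<Rightarrow> real^2 \<Rightarrow> real^2" where
  "mittenpunkt P Q R =
     (THE X. X \<in> affine hull {excenter P Q R, midpoint Q R} \<and>
             X \<in> affine hull {excenter Q R P, midpoint R P} \<and>
             X \<in> affine hull {excenter R P Q, midpoint P Q})"

lemma norm_eq_orthonormal_2:
  fixes u v x :: "real^2"
  assumes "norm u = 1" "norm v = 1" "u \<bullet> v = 0"
  shows "(norm x)\<^sup>2 = (x \<bullet> u)\<^sup>2 + (x \<bullet> v)\<^sup>2"
proof -
  have u: "u$1 * u$1 + u$2 * u$2 = 1" and v: "v$1 * v$1 + v$2 * v$2 = 1"
    and uv: "u$1 * v$1 + u$2 * v$2 = 0"
    using assms by (simp_all add: norm_eq_1 inner_vec_def sum_2)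
  define d where "d = u$1 * v$2 - u$2 * v$1"
  have v2: "v$2 = d * u$1" and v1: "v$1 = - d * u$2"
    using u uv unfolding d_def by algebra+
  have d: "d * d = 1" using u v unfolding v1 v2 by algebra
  have "(x$1)\<^sup>2 + (x$2)\<^sup>2 = (x$1 * u$1 + x$2 * u$2)\<^sup>2 + (x$1 * v$1 + x$2 * v$2)\<^sup>2"
    using u d unfolding v1 v2 by algebra
  then show ?thesis
    unfolding power2_norm_eq_inner by (simp add: inner_vec_def sum_2 power2_eq_square)
qed

lemma ellipse_centered_at_imp:
  assumes "ellipse_centered_at E c"
  shows "E \<noteq> {}" and "bounded E" and "\<And>x. x \<in> E \<Longrightarrow> 2 *\<^sub>R c - x \<in> E"
proof -
  obtain u v a b where uv: "norm u = 1" "norm v = 1" "u \<bullet> v = 0" and ab: "0 < a" "0 < b"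
    and E: "E = {x. (((x - c) \<bullet> u) / a)\<^sup>2 + (((x - c) \<bullet> v) / b)\<^sup>2 = 1}"
    using assms unfolding ellipse_centered_at_def by blast
  have "c + a *\<^sub>R u \<in> E"
    using uv ab by (simp add: E norm_eq_1)
  then show "E \<noteq> {}" by blast
  have "norm (x - c) \<le> sqrt (a\<^sup>2 + b\<^sup>2)" if "x \<in> E" for x
  proof -
    define s t where "s = ((x - c) \<bullet> u) / a" and "t = ((x - c) \<bullet> v) / b"
    have st: "s\<^sup>2 + t\<^sup>2 = 1" using that by (simp add: E s_def t_def)
    have "(norm (x - c))\<^sup>2 = a\<^sup>2 * s\<^sup>2 + b\<^sup>2 * t\<^sup>2"
      using norm_eq_orthonormal_2[OF uv] ab by (simp add: s_def t_def power_divide)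
    also have "\<dots> \<le> a\<^sup>2 * 1 + b\<^sup>2 * 1"
      by (intro add_mono mult_left_mono)
        (use st zero_le_power2[of s] zero_le_power2[of t] in \<open>linarith | simp\<close>)+
    finally show ?thesis by (simp add: real_le_rsqrt)
  qed
  then show "bounded E"
    by (metis bounded_iff bounded_subset bounded_cball mem_cball dist_norm norm_minus_commute subsetI)
  show "2 *\<^sub>R c - x \<in> E" if "x \<in> E" for x
  proof -
    have "2 *\<^sub>R c - x - c = - (x - c)" by (simp add: scaleR_2)
    then show ?thesis using that unfolding E mem_Collect_eq
      by (metis inner_minus_left minus_divide_left power2_minus)
  qed
qed

lemma ellipse_center_eq:
  assumes "ellipse_centered_at E c"
  shows "ellipse_center E = c"
  unfolding ellipse_center_def
proof (rule the_equality[where P = "ellipse_centered_at E", OF assms])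
  fix d assume d: "ellipse_centered_at E d"
  obtain x where x: "x \<in> E" using ellipse_centered_at_imp(1)[OF assms] by blast
  have step: "y + 2 *\<^sub>R (d - c) \<in> E" if "y \<in> E" for y
    using ellipse_centered_at_imp(3)[OF d ellipse_centered_at_imp(3)[OF assms that]]
    by (simp add: algebra_simps)
  have iter: "x + real n *\<^sub>R (2 *\<^sub>R (d - c)) \<in> E" for n
  proof (induction n)
    case (Suc n)
    then show ?case using step[OF Suc] by (simp add: scaleR_add_left algebra_simps)
  qed (use x in simp)
  obtain B where B: "\<And>y. y \<in> E \<Longrightarrow> norm y \<le> B"
    using ellipse_centered_at_imp(2)[OF assms] bounded_iff by blast
  have "real n * norm (2 *\<^sub>R (d - c)) \<le> B + norm x" for n
  proof -
    have "norm (real n *\<^sub>R (2 *\<^sub>R (d - c))) \<le> norm (x + real n *\<^sub>R (2 *\<^sub>R (d - c))) + norm x"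
      by (metis add_diff_cancel_left' norm_triangle_ineq4)
    then show ?thesis using B[OF iter[of n]] by simp
  qed
  then have "norm (2 *\<^sub>R (d - c)) \<le> 0"
    by (metis ex_less_of_nat_mult not_le)
  then show "d = c" by simp
qed

end

theory Submission
  imports Defs
begin

text \<open>An ellipse is a circle for another inner product, and this turns the billiard condition into
  a condition on the side vectors alone.  Let \<open>E = {x. B (x - c) (x - c) = 1}\<close> with \<open>B\<close> a symmetric
  positive definite bilinear form.  The tangent of \<open>E\<close> at \<open>P\<close> consists of the \<open>w\<close> with
  \<open>B (P - c) w = 0\<close>.  The normal at \<open>P\<close> bisects the angle of the triangle \<open>P Q R\<close> internally iff the
  difference of the unit vectors from \<open>P\<close> to \<open>R\<close> and to \<open>Q\<close> is tangent.  Since \<open>P\<close> and \<open>Q\<close> lie on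
  \<open>E\<close>, we have \<open>2 B (P - c) (Q - P) = - B (Q - P) (Q - P)\<close>, so the condition at \<open>P\<close> says that \<open>B w w / norm w\<close>
  takes the same value on the two sides at \<open>P\<close>.  Hence a triangle inscribed in \<open>E\<close> is a billiard
  3-periodic iff the form \<open>B w w\<close> is proportional, on its three sides, to their ordinary lengths
  (\<open>billiard_form_circle_iff\<close>).

  A quadratic form on the plane is determined by its values on the three sides, so \<open>B\<close> is unique up
  to a factor (\<open>form_on_sides_unique\<close>), and \<open>E\<close> must be the circumscribed circle for \<open>B\<close>, whose center
  and radius the triangle determines.  Conversely, the symmetric form whose values on
  the sides are the side lengths \<open>a\<close>, \<open>b\<close>, \<open>c\<close> is positive definite, because its Gram determinant is a quarter of
  \<open>a (b + c - a) + b (c + a - b) + c (a + b - c)\<close>, which the triangle inequality makes positive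
  (\<open>ex_side_length_form\<close>).  This gives existence.

  For the center, the excenter opposite \<open>P\<close> is \<open>(- a P + b Q + c R) / (- a + b + c)\<close>, and a short
  computation shows that it is equidistant from \<open>Q\<close> and \<open>R\<close> for the same form.  The line from it to
  the midpoint of \<open>Q R\<close> is therefore the perpendicular bisector of \<open>Q R\<close> in that inner product
  (\<open>excenter_median_line\<close>).  So the three lines that define the Mittenpunkt are the three
  perpendicular bisectors of the triangle, and they concur in the circumcenter, which is the center of
  \<open>E\<close>.\<close>

section \<open>Plane vectors and triangles\<close>

definition cross2 :: "real^2 \<Rightarrow> real^2 \<Rightarrow> real" where
  "cross2 x y = x$1 * y$2 - x$2 * y$1"

lemma cross2_self: "cross2 x x = 0"
  by (simp add: cross2_def)

lemma cross2_scaleR_right: "cross2 x (s *\<^sub>R y) = s * cross2 x y"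
  by (simp add: cross2_def algebra_simps)

lemma cross2_expand: "cross2 u v *\<^sub>R w = cross2 w v *\<^sub>R u + cross2 u w *\<^sub>R v"
  by (simp add: vec_eq_iff forall_2 cross2_def algebra_simps)

lemma cross2_basis:
  assumes "cross2 u v \<noteq> 0"
  obtains s t where "w = s *\<^sub>R u + t *\<^sub>R v"
proof
  have "w = (1 / cross2 u v) *\<^sub>R (cross2 u v *\<^sub>R w)" using assms by simp
  then show "w = (cross2 w v / cross2 u v) *\<^sub>R u + (cross2 u w / cross2 u v) *\<^sub>R v"
    unfolding cross2_expand[of u v w] by (simp add: scaleR_add_right)
qed

lemma cross2_eq_0_imp:
  assumes "cross2 u w = 0" and "u \<noteq> 0"
  obtains s where "w = s *\<^sub>R u"
proof (cases "u$1 = 0")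
  case True
  with \<open>u \<noteq> 0\<close> have "u$2 \<noteq> 0" by (simp add: vec_eq_iff forall_2)
  with True assms(1) have "w = (w$2 / u$2) *\<^sub>R u"
    by (simp add: vec_eq_iff forall_2 cross2_def)
  then show ?thesis by (rule that)
next
  case False
  with assms(1) have "w = (w$1 / u$1) *\<^sub>R u"
    by (simp add: vec_eq_iff forall_2 cross2_def field_simps)
  then show ?thesis by (rule that)
qed

definition nondegenerate :: "real^2 \<Rightarrow> real^2 \<Rightarrow> real^2 \<Rightarrow> bool" where
  "nondegenerate P Q R \<longleftrightarrow> cross2 (Q - P) (R - P) \<noteq> 0"

lemma nondegenerate_rotate: "nondegenerate P Q R \<Longrightarrow> nondegenerate Q R P"
  by (simp add: nondegenerate_def cross2_def algebra_simps)

lemma nondegenerate_neq: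
  assumes "nondegenerate P Q R"
  shows "P \<noteq> Q" "Q \<noteq> R" "R \<noteq> P"
  using assms by (auto simp: nondegenerate_def cross2_def)

lemma not_collinear_imp_nondegenerate:
  assumes "\<not> collinear {P, Q, R}"
  shows "nondegenerate P Q R"
proof (rule ccontr)
  assume "\<not> nondegenerate P Q R"
  then have 0: "cross2 (Q - P) (R - P) = 0" by (simp add: nondegenerate_def)
  have "Q - P \<noteq> 0" using assms by auto
  then obtain s where s: "R - P = s *\<^sub>R (Q - P)" by (rule cross2_eq_0_imp[OF 0])
  have "collinear {0, Q - P, R - P}" unfolding collinear_lemma using s by blast
  moreover have "collinear {0, Q - P, R - P} \<longleftrightarrow> collinear {Q, P, R}"
    using collinear_3[of Q P R] by (simp add: insert_commute)
  ultimately show False using assms by (simp add: insert_commute)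
qed

lemma strict_triangle_inequality:
  assumes "nondegenerate P Q R"
  shows "norm (P - R) < norm (Q - P) + norm (R - Q)"
proof -
  have "norm (Q - P + (R - Q)) \<noteq> norm (Q - P) + norm (R - Q)"
  proof
    assume "norm (Q - P + (R - Q)) = norm (Q - P) + norm (R - Q)"
    then have "norm (Q - P) *\<^sub>R (R - Q) = norm (R - Q) *\<^sub>R (Q - P)"
      by (simp only: norm_triangle_eq)
    then have "norm (Q - P) * cross2 (Q - P) (R - Q) = 0"
      by (metis cross2_scaleR_right cross2_self mult_zero_right)
    moreover have "cross2 (Q - P) (R - Q) = cross2 (Q - P) (R - P)"
      by (simp add: cross2_def algebra_simps)
    ultimately show False
      using assms nondegenerate_neq(1)[OF assms] by (simp add: nondegenerate_def)
  qed
  moreover have "norm (Q - P + (R - Q)) = norm (P - R)"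
    by (simp add: norm_minus_commute)
  ultimately show ?thesis using norm_triangle_ineq[of "Q - P" "R - Q"] by linarith
qed

lemma strict_triangle_inequalities:
  assumes "nondegenerate P Q R"
  shows "norm (R - Q) < norm (P - R) + norm (Q - P)"
    and "norm (P - R) < norm (Q - P) + norm (R - Q)"
    and "norm (Q - P) < norm (R - Q) + norm (P - R)"
  using strict_triangle_inequality[OF assms]
    strict_triangle_inequality[OF nondegenerate_rotate[OF assms]]
    strict_triangle_inequality[OF nondegenerate_rotate[OF nondegenerate_rotate[OF assms]]]
  by (simp_all add: norm_minus_commute)

section \<open>Inner products on the plane\<close>

locale inner_form =
  fixes B :: "real^2 \<Rightarrow> real^2 \<Rightarrow> real"
  assumes bilinear: "bilinear B"
    and sym: "B x y = B y x"
    and pos: "x \<noteq> 0 \<Longrightarrow> 0 < B x x"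
begin

lemmas bilin_simps =
  bilinear_ladd[OF bilinear] bilinear_radd[OF bilinear]
  bilinear_lsub[OF bilinear] bilinear_rsub[OF bilinear]
  bilinear_lmul[OF bilinear] bilinear_rmul[OF bilinear]
  bilinear_lneg[OF bilinear] bilinear_rneg[OF bilinear]
  bilinear_lzero[OF bilinear] bilinear_rzero[OF bilinear]

lemma orthogonal_imp_parallel:
  assumes "B x u = 0" "B x v = 0" "x \<noteq> 0"
  shows "cross2 u v = 0"
proof (rule ccontr)
  assume "cross2 u v \<noteq> 0"
  then obtain s t where x: "x = s *\<^sub>R u + t *\<^sub>R v" by (rule cross2_basis)
  have "B x x = s * B x u + t * B x v"
    using arg_cong[OF x, of "B x"] by (simp only: bilin_simps real_scaleR_def)
  with assms pos[of x] show False by simp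
qed

text \<open>The line through two points of equal height in a direction \<open>v\<close> is the whole level set, since the
  \<open>B\<close>-orthogonal complement of \<open>v\<close> in the plane is one-dimensional.\<close>

lemma line_eq:
  assumes "v \<noteq> 0" "X \<noteq> Y" "B (X - A) v = h" "B (Y - A) v = h"
  shows "affine hull {X, Y} = {x. B (x - A) v = h}"
proof (intro equalityI subsetI)
  fix x assume "x \<in> affine hull {X, Y}"
  then obtain t where x: "x = X + t *\<^sub>R (Y - X)" by (auto simp: affine_hull_2_alt)
  have "B (x - A) v = B (X - A) v + t * (B (Y - A) v - B (X - A) v)"
    unfolding x by (simp add: bilin_simps algebra_simps)
  with assms show "x \<in> {x. B (x - A) v = h}" by simp
next
  fix x assume "x \<in> {x. B (x - A) v = h}"
  then have "B v (Y - X) = 0" "B v (x - X) = 0"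
    using assms(3,4) by (simp_all add: bilin_simps sym[of v])
  then have "cross2 (Y - X) (x - X) = 0" using \<open>v \<noteq> 0\<close> by (rule orthogonal_imp_parallel)
  moreover have "Y - X \<noteq> 0" using \<open>X \<noteq> Y\<close> by simp
  ultimately obtain t where "x - X = t *\<^sub>R (Y - X)" by (rule cross2_eq_0_imp)
  then have "x = X + t *\<^sub>R (Y - X)" by (simp add: diff_eq_eq add.commute)
  then show "x \<in> affine hull {X, Y}" by (auto simp: affine_hull_2_alt)
qed

text \<open>The principal axes of the form.  Rotating the coordinate axes by \<open>\<theta> / 2\<close> rotates the pair
  formed by the difference of the diagonal entries and twice the off-diagonal entry by \<open>\<theta>\<close>, so half the polar angle of
  this pair removes the mixed term.\<close>

lemma diagonalize:
  obtains u v a b where "norm u = 1" "norm v = 1" "u \<bullet> v = 0" "0 < a" "0 < b"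
    "\<And>x. B x x = ((x \<bullet> u) / a)\<^sup>2 + ((x \<bullet> v) / b)\<^sup>2"
proof -
  define e f :: "real^2" where "e = vector [1, 0]" and "f = vector [0, 1]"
  obtain r \<theta> where r: "B e e - B f f = r * cos \<theta>" "2 * B e f = r * sin \<theta>"
    using polar_Ex by blast
  define C S where "C = cos (\<theta> / 2)" and "S = sin (\<theta> / 2)"
  have CS: "C * C + S * S = 1" unfolding C_def S_def
    using sin_cos_squared_add3 by blast
  have \<theta>: "cos \<theta> = C * C - S * S" "sin \<theta> = 2 * S * C"
    using cos_double[of "\<theta>/2"] sin_double[of "\<theta>/2"]
    by (simp_all add: C_def S_def power2_eq_square)
  define u v :: "real^2" where "u = C *\<^sub>R e + S *\<^sub>R f" and "v = C *\<^sub>R f - S *\<^sub>R e"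
  have uv: "u = vector [C, S]" "v = vector [- S, C]"
    by (simp_all add: u_def v_def e_def f_def vec_eq_iff forall_2)
  have uu: "norm u = 1" "norm v = 1" "u \<bullet> v = 0"
    using CS by (simp_all add: uv norm_eq_1 inner_vec_def sum_2)
  have "B u v = (B f f - B e e) * C * S + B e f * (C * C - S * S)"
    by (simp add: u_def v_def bilin_simps sym[of f e] algebra_simps)
  also have "\<dots> = 0"
  proof -
    have "2 * ((B f f - B e e) * C * S + B e f * (C * C - S * S)) = 0"
      using r unfolding \<theta> by algebra
    then show ?thesis by simp
  qed
  finally have Buv: "B u v = 0" .
  have x: "x = (x \<bullet> u) *\<^sub>R u + (x \<bullet> v) *\<^sub>R v" for x
  proof -
    have "x$1 = (x$1 * C + x$2 * S) * C + (x$2 * C - x$1 * S) * (- S)"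
         "x$2 = (x$1 * C + x$2 * S) * S + (x$2 * C - x$1 * S) * C" using CS by algebra+
    then show ?thesis by (simp add: uv vec_eq_iff forall_2 inner_vec_def sum_2)
  qed
  have "u \<noteq> 0" "v \<noteq> 0" using uu by auto
  then have p: "0 < B u u" "0 < B v v" by (auto intro: pos)
  show ?thesis
  proof (rule that[OF uu])
    show "0 < 1 / sqrt (B u u)" "0 < 1 / sqrt (B v v)" using p by simp_all
    fix x
    have "B x x = B ((x \<bullet> u) *\<^sub>R u + (x \<bullet> v) *\<^sub>R v) ((x \<bullet> u) *\<^sub>R u + (x \<bullet> v) *\<^sub>R v)"
      by (rule arg_cong2[OF x x])
    also have "\<dots> = (x \<bullet> u)\<^sup>2 * B u u + (x \<bullet> v)\<^sup>2 * B v v"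
      by (simp add: bilin_simps Buv sym[of v u] power2_eq_square)
    finally show "B x x = ((x \<bullet> u) / (1 / sqrt (B u u)))\<^sup>2 + ((x \<bullet> v) / (1 / sqrt (B v v)))\<^sup>2"
      using p by (simp add: power_mult_distrib)
  qed
qed

end

text \<open>The circle for \<open>B\<close> of squared radius \<open>\<rho>\<close>.\<close>

definition form_circle :: "(real^2 \<Rightarrow> real^2 \<Rightarrow> real) \<Rightarrow> real^2 \<Rightarrow> real \<Rightarrow> (real^2) set" where
  "form_circle B c \<rho> = {x. B (x - c) (x - c) = \<rho>}"

lemma ellipse_iff_form_circle:
  "ellipse_centered_at E c \<longleftrightarrow> (\<exists>B. inner_form B \<and> E = form_circle B c 1)"
proof
  assume "ellipse_centered_at E c"
  then obtain u v a b where uv: "norm u = 1" "norm v = 1" "u \<bullet> v = 0" and ab: "0 < a" "0 < b"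
    and E: "E = {x. (((x - c) \<bullet> u) / a)\<^sup>2 + (((x - c) \<bullet> v) / b)\<^sup>2 = 1}"
    unfolding ellipse_centered_at_def by blast
  define B where "B = (\<lambda>x y. (x \<bullet> u) * (y \<bullet> u) / a\<^sup>2 + (x \<bullet> v) * (y \<bullet> v) / b\<^sup>2)"
  have "inner_form B"
  proof
    show "bilinear B" unfolding B_def bilinear_def
      by (auto intro!: linearI simp: inner_add_left algebra_simps add_divide_distrib)
    show "B x y = B y x" for x y by (simp add: B_def mult.commute)
    fix x :: "real^2" assume "x \<noteq> 0"
    then have "0 < (x \<bullet> u)\<^sup>2 + (x \<bullet> v)\<^sup>2"
      unfolding norm_eq_orthonormal_2[OF uv, symmetric] by simp
    then have "x \<bullet> u \<noteq> 0 \<or> x \<bullet> v \<noteq> 0" by auto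
    moreover have "B x x = ((x \<bullet> u) / a)\<^sup>2 + ((x \<bullet> v) / b)\<^sup>2"
      by (simp add: B_def power2_eq_square)
    ultimately show "0 < B x x" using ab by (simp add: sum_power2_gt_zero_iff)
  qed
  moreover have "E = form_circle B c 1"
    by (simp add: E form_circle_def B_def power_divide power2_eq_square)
  ultimately show "\<exists>B. inner_form B \<and> E = form_circle B c 1" by blast
next
  assume "\<exists>B. inner_form B \<and> E = form_circle B c 1"
  then obtain B where B: "inner_form B" and E: "E = form_circle B c 1" by blast
  interpret inner_form B by fact
  show "ellipse_centered_at E c"
    by (rule diagonalize) (auto simp: E form_circle_def ellipse_centered_at_def)
qed

context inner_form
begin

text \<open>Differentiating the equation of the circle gives one inclusion.  For the other, a tangent vector is
  the velocity of the uniform rotation for \<open>B\<close>, whose angular speed is the \<open>B\<close>-length of the vector.\<close>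

lemma tangent_vectors_form_circle:
  assumes "p \<in> form_circle B c 1"
  shows "tangent_vectors (form_circle B c 1) p = {w. B (p - c) w = 0}"
proof (intro equalityI subsetI)
  interpret bb: bounded_bilinear B using bilinear by (simp add: bilinear_conv_bounded_bilinear)
  fix w assume "w \<in> tangent_vectors (form_circle B c 1) p"
  then obtain g where g: "\<And>t. B (g t - c) (g t - c) = 1" "g 0 = p"
    and d: "(g has_vector_derivative w) (at 0)"
    by (auto simp: tangent_vectors_def form_circle_def)
  have "((\<lambda>t. g t - c) has_vector_derivative w) (at 0)"
    by (auto intro!: derivative_eq_intros d)
  from bb.has_vector_derivative[OF this this]
  have "((\<lambda>t. 1) has_vector_derivative 2 * B (p - c) w) (at (0::real))"
    using sym[of w "p - c"] by (simp add: g)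
  then show "w \<in> {w. B (p - c) w = 0}"
    using vector_derivative_unique_at[OF _ has_vector_derivative_const] by fastforce
next
  fix w assume "w \<in> {w. B (p - c) w = 0}"
  then have w: "B (p - c) w = 0" by simp
  define n where "n = sqrt (B w w)"
  have n: "n * n = B w w" using pos[of w] bilin_simps unfolding n_def
    by (cases "w = 0") simp_all
  have p: "B (p - c) (p - c) = 1" using assms by (simp add: form_circle_def)
  show "w \<in> tangent_vectors (form_circle B c 1) p"
  proof (cases "w = 0")
    case True
    then show ?thesis using assms
      by (auto simp: tangent_vectors_def intro!: exI[of _ "\<lambda>_. p"])
  next
    case False
    then have n0: "n \<noteq> 0" using n pos[of w] by auto
    define d where "d = p - c"
    have d: "B d d = 1" "B d w = 0" "B w d = 0" using p w sym[of w "p - c"] by (simp_all add: d_def)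
    define g where "g = (\<lambda>t. c + (cos (n * t) *\<^sub>R d + (sin (n * t) / n) *\<^sub>R w))"
    have "g t \<in> form_circle B c 1" for t
    proof -
      have "B (g t - c) (g t - c) = cos (n*t) * cos (n*t) + (sin (n*t) / n) * (sin (n*t) / n) * (n * n)"
        by (simp add: g_def bilin_simps d n)
      also have "\<dots> = cos (n*t) * cos (n*t) + sin (n*t) * sin (n*t)" using n0 by simp
      also have "\<dots> = 1" by (rule sin_cos_squared_add3)
      finally show ?thesis by (simp add: form_circle_def)
    qed
    moreover have "g 0 = p" by (simp add: g_def d_def)
    moreover have "(g has_vector_derivative w) (at 0)"
    proof -
      have "((\<lambda>t. cos (n * t)) has_real_derivative 0) (at 0)"
        "((\<lambda>t. sin (n * t) / n) has_real_derivative 1) (at 0)"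
        using n0 by (auto intro!: derivative_eq_intros)
      then have "((\<lambda>t. cos (n * t) *\<^sub>R d) has_vector_derivative 0) (at 0)"
        "((\<lambda>t. (sin (n * t) / n) *\<^sub>R w) has_vector_derivative w) (at 0)"
        using has_vector_derivative_scaleR[OF _ has_vector_derivative_const] by fastforce+
      from has_vector_derivative_add[OF has_vector_derivative_const[of c]
          has_vector_derivative_add[OF this]]
      show ?thesis by (simp add: g_def)
    qed
    ultimately show ?thesis by (auto simp: tangent_vectors_def)
  qed
qed

end


section \<open>Angle bisectors and normals\<close>

lemma inner_form_inner: "inner_form (\<bullet>)"
  by standard (auto simp: bilinear_def inner_commute intro!: linearI
      simp: inner_add_left inner_add_right)

interpretation euclidean: inner_form "(\<bullet>)"
  by (rule inner_form_inner)

definition rot90 :: "real^2 \<Rightarrow> real^2" where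
  "rot90 x = vector [- x$2, x$1]"

lemma inner_rot90: "rot90 x \<bullet> y = cross2 x y"
  by (simp add: rot90_def cross2_def inner_vec_def sum_2)

lemma cross2_rot90: "cross2 x (rot90 x) = x \<bullet> x"
  by (simp add: rot90_def cross2_def inner_vec_def sum_2)

lemma sgn_diff_neq_0:
  assumes "nondegenerate P Q R"
  shows "sgn (R - P) - sgn (Q - P) \<noteq> 0"
proof
  assume "sgn (R - P) - sgn (Q - P) = 0"
  then have "sgn (R - P) = sgn (Q - P)" by simp
  have "R - P = norm (R - P) *\<^sub>R sgn (R - P)"
    using nondegenerate_neq(3)[OF assms] by (simp add: sgn_div_norm)
  also have "\<dots> = (norm (R - P) / norm (Q - P)) *\<^sub>R (Q - P)"
    unfolding \<open>sgn (R - P) = sgn (Q - P)\<close> by (simp add: sgn_div_norm divide_inverse)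
  finally have "cross2 (Q - P) (R - P) = 0"
    by (metis cross2_scaleR_right cross2_self mult_zero_right)
  with assms show False by (simp add: nondegenerate_def)
qed

text \<open>Both cosines are inner products with the unit vector along \<open>y\<close>, so equality of the angles is a
  linear condition on \<open>y\<close>.\<close>

lemma vec_angle_eq_iff:
  assumes "y \<noteq> 0"
  shows "vec_angle x y = vec_angle y z \<longleftrightarrow> y \<bullet> (sgn x - sgn z) = 0"
proof -
  have sgn: "vec_angle x y = arccos (sgn x \<bullet> sgn y)" for x y
    by (simp add: vec_angle_def sgn_div_norm divide_inverse mult_ac)
  have le: "\<bar>sgn x \<bullet> sgn y\<bar> \<le> 1" for x y :: "real^2"
    using Cauchy_Schwarz_ineq2[of "sgn x" "sgn y"] by (auto simp: norm_sgn split: if_splits)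
  have "vec_angle x y = vec_angle y z \<longleftrightarrow> sgn y \<bullet> (sgn x - sgn z) = 0"
    unfolding sgn arccos_eq_iff[OF conjI[OF le le]]
    by (auto simp: inner_diff_right inner_commute)
  also have "\<dots> \<longleftrightarrow> y \<bullet> (sgn x - sgn z) = 0"
    using assms by (simp add: sgn_div_norm)
  finally show ?thesis .
qed

text \<open>The internal bisector is orthogonal to the difference of the two unit vectors along the sides, which is
  the direction of the external bisector.  It meets the opposite side because the sum of these unit
  vectors, after scaling, points to a weighted mean of \<open>R\<close> and \<open>Q\<close>.\<close>

lemma internal_angle_bisector_iff:
  assumes nd: "nondegenerate P Q R"
  shows "internal_angle_bisector L R P Q \<longleftrightarrow>
    L = {x. (x - P) \<bullet> (sgn (R - P) - sgn (Q - P)) = 0}" (is "_ \<longleftrightarrow> L = ?N")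
proof -
  define p q where "p = norm (R - P)" and "q = norm (Q - P)"
  have pq: "p > 0" "q > 0" using nondegenerate_neq[OF nd] by (auto simp: p_def q_def)
  have seg: "X \<noteq> P" if "X \<in> open_segment R Q" for X
  proof
    assume "X = P"
    obtain t where t: "t < 1" "X = (1 - t) *\<^sub>R R + t *\<^sub>R Q"
      using \<open>X \<in> open_segment R Q\<close> unfolding in_segment by blast
    then have "X - P = (1 - t) *\<^sub>R (R - P) + t *\<^sub>R (Q - P)" by (simp add: algebra_simps)
    then have "cross2 (Q - P) (X - P) = cross2 (Q - P) ((1 - t) *\<^sub>R (R - P) + t *\<^sub>R (Q - P))"
      by (rule arg_cong)
    then have "(1 - t) * cross2 (Q - P) (R - P) = cross2 (Q - P) (X - P)"
      by (simp add: cross2_def algebra_simps)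
    also have "\<dots> = 0" by (simp add: \<open>X = P\<close> cross2_def)
    finally show False using nd t by (simp add: nondegenerate_def)
  qed
  have key: "vec_angle (R - P) (X - P) = vec_angle (X - P) (Q - P) \<and> L = affine hull {P, X}
      \<longleftrightarrow> X \<in> ?N \<and> L = ?N" if "X \<in> open_segment R Q" for X
  proof -
    have "vec_angle (R - P) (X - P) = vec_angle (X - P) (Q - P) \<longleftrightarrow> X \<in> ?N"
      using vec_angle_eq_iff[of "X - P"] seg[OF that] by simp
    moreover have "affine hull {P, X} = ?N" if "X \<in> ?N"
      by (rule euclidean.line_eq[OF sgn_diff_neq_0[OF nd]])
        (use that seg[OF \<open>X \<in> open_segment R Q\<close>] in auto)
    ultimately show ?thesis by blast
  qed
  \<comment> \<open>The bisector divides the opposite side in the ratio of the adjacent sides.\<close>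
  define t where "t = p / (p + q)"
  define X where "X = (1 - t) *\<^sub>R R + t *\<^sub>R Q"
  have t: "0 < t" "t < 1" and tpq: "(1 - t) * p = t * q"
    using pq by (auto simp: t_def field_simps)
  have X: "X \<in> open_segment R Q"
    using t nondegenerate_neq[OF nd] by (auto simp: in_segment X_def)
  have "X - P = (1 - t) *\<^sub>R (R - P) + t *\<^sub>R (Q - P)" by (simp add: X_def algebra_simps)
  also have "\<dots> = ((1 - t) * p) *\<^sub>R sgn (R - P) + (t * q) *\<^sub>R sgn (Q - P)"
  proof -
    have "p *\<^sub>R sgn (R - P) = R - P" "q *\<^sub>R sgn (Q - P) = Q - P"
      using pq by (simp_all add: sgn_div_norm p_def q_def)
    then show ?thesis by (simp flip: scaleR_scaleR)
  qed
  also have "\<dots> = (t * q) *\<^sub>R (sgn (R - P) + sgn (Q - P))"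
    by (simp add: tpq scaleR_add_right)
  finally have XP: "X - P = (t * q) *\<^sub>R (sgn (R - P) + sgn (Q - P))" .
  have "sgn x \<bullet> sgn x = 1" if "x \<noteq> 0" for x :: "real^2"
    using that by (simp add: norm_sgn flip: norm_eq_1)
  then have "sgn (R - P) \<bullet> sgn (R - P) = sgn (Q - P) \<bullet> sgn (Q - P)"
    using nondegenerate_neq[OF nd] by simp
  then have "(sgn (R - P) + sgn (Q - P)) \<bullet> (sgn (R - P) - sgn (Q - P)) = 0"
    by (simp only: inner_add_left inner_diff_right) (simp add: inner_commute)
  then have "X \<in> ?N" unfolding mem_Collect_eq XP inner_scaleR_left by simp
  with X show ?thesis unfolding internal_angle_bisector_def using key by blast
qed

context inner_form
begin

text \<open>The normal is orthogonal to \<open>d\<close> iff the tangent, which is one-dimensional, is spanned by \<open>d\<close>.\<close>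

lemma normal_line_form_circle_eq_iff:
  assumes "p \<in> form_circle B c 1" "d \<noteq> 0"
  shows "normal_line (form_circle B c 1) p = {x. (x - p) \<bullet> d = 0} \<longleftrightarrow> B (p - c) d = 0"
proof -
  define n where "n = p - c"
  have n: "n \<noteq> 0" using assms(1) by (auto simp: form_circle_def n_def bilin_simps)
  have N: "normal_line (form_circle B c 1) p = {x. \<forall>w. B n w = 0 \<longrightarrow> (x - p) \<bullet> w = 0}"
    by (simp add: normal_line_def tangent_vectors_form_circle[OF assms(1)] n_def)
  show ?thesis
  proof
    assume "normal_line (form_circle B c 1) p = {x. (x - p) \<bullet> d = 0}"
    moreover have "p + rot90 d \<in> {x. (x - p) \<bullet> d = 0}" by (simp add: inner_rot90 cross2_self)
    ultimately have "p + rot90 d \<in> {x. \<forall>w. B n w = 0 \<longrightarrow> (x - p) \<bullet> w = 0}"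
      unfolding N by (rule ssubst)
    then have *: "cross2 d w = 0" if "B n w = 0" for w
      using that by (simp add: inner_rot90)
    \<comment> \<open>A tangent vector whose component transversal to \<open>d\<close> is a multiple of \<open>B n d\<close>.\<close>
    define w where "w = B n (rot90 d) *\<^sub>R d - B n d *\<^sub>R rot90 d"
    have "B n w = 0" by (simp add: w_def bilin_simps)
    then have "0 = cross2 d w" by (simp add: *)
    also have "\<dots> = - (B n d * cross2 d (rot90 d))"
      by (simp add: w_def cross2_def algebra_simps)
    finally show "B (p - c) d = 0" using assms(2) by (simp add: cross2_rot90 n_def)
  next
    assume d: "B (p - c) d = 0"
    have "\<exists>s. w = s *\<^sub>R d" if "B n w = 0" for w
      using orthogonal_imp_parallel[of n d w] d that n cross2_eq_0_imp[OF _ assms(2)]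
      unfolding n_def by blast
    then show "normal_line (form_circle B c 1) p = {x. (x - p) \<bullet> d = 0}"
      unfolding N using d unfolding n_def by fastforce
  qed
qed

text \<open>Expanding \<open>q - c = (p - c) + (q - p)\<close> in the equation of the circle replaces a product with the
  radius, which involves the center, by a product of the chord with itself, which does not.\<close>

lemma chord_form:
  assumes "p \<in> form_circle B c \<rho>" "q \<in> form_circle B c \<rho>"
  shows "2 * B (p - c) (q - p) = - B (q - p) (q - p)"
proof -
  have "B (q - c) (q - c) = B (p - c) (p - c) + 2 * B (p - c) (q - p) + B (q - p) (q - p)"
    using sym[of p q] sym[of c p] sym[of c q] by (simp add: bilin_simps)
  with assms show ?thesis by (simp add: form_circle_def)
qed

text \<open>The external bisector direction is tangent at \<open>P\<close> iff the two unit vectors have the same product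
  with the radius, and by the chord identity these products are, up to the factor \<open>- 1 / 2\<close>, the
  quotients below.\<close>

lemma bisecting_normal_iff:
  assumes nd: "nondegenerate P Q R"
    and E: "P \<in> form_circle B c 1" "Q \<in> form_circle B c 1" "R \<in> form_circle B c 1"
  shows "internal_angle_bisector (normal_line (form_circle B c 1) P) R P Q \<longleftrightarrow>
    B (P - R) (P - R) / norm (P - R) = B (Q - P) (Q - P) / norm (Q - P)"
proof -
  have split: "B z (sgn x - sgn y) = B z x / norm x - B z y / norm y" for x y z
    by (simp add: bilin_simps sgn_div_norm divide_inverse mult.commute)
  have "B (P - R) (P - R) = B (R - P) (R - P)" by (simp add: bilin_simps)
  then have flip: "B (R - P) (R - P) / norm (R - P) = B (P - R) (P - R) / norm (P - R)"
    by (simp add: norm_minus_commute)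
  have "internal_angle_bisector (normal_line (form_circle B c 1) P) R P Q \<longleftrightarrow>
      B (P - c) (sgn (R - P) - sgn (Q - P)) = 0"
    using internal_angle_bisector_iff[OF nd]
      normal_line_form_circle_eq_iff[OF E(1) sgn_diff_neq_0[OF nd]] by simp
  also have "\<dots> \<longleftrightarrow> 2 * B (P - c) (R - P) / norm (R - P) = 2 * B (P - c) (Q - P) / norm (Q - P)"
    unfolding split by (simp flip: times_divide_eq_right)
  also have "\<dots> \<longleftrightarrow> B (R - P) (R - P) / norm (R - P) = B (Q - P) (Q - P) / norm (Q - P)"
    unfolding chord_form[OF E(1,3)] chord_form[OF E(1,2)] by simp
  finally show ?thesis unfolding flip .
qed

end

section \<open>The form that measures the sides by their lengths\<close>

text \<open>The squared \<open>B\<close>-lengths of the sides are proportional to the Euclidean lengths, which are not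
  squared here.\<close>

definition form_on_sides ::
    "(real^2 \<Rightarrow> real^2 \<Rightarrow> real) \<Rightarrow> real \<Rightarrow> real^2 \<Rightarrow> real^2 \<Rightarrow> real^2 \<Rightarrow> bool" where
  "form_on_sides B k P Q R \<longleftrightarrow>
     B (Q - P) (Q - P) = k * norm (Q - P) \<and>
     B (R - Q) (R - Q) = k * norm (R - Q) \<and>
     B (P - R) (P - R) = k * norm (P - R)"

lemma form_on_sides_rotate: "form_on_sides B k P Q R \<Longrightarrow> form_on_sides B k Q R P"
  by (simp add: form_on_sides_def)

text \<open>The three bisector conditions compare the ratio \<open>B w w / norm w\<close> of each side with that of the
  next one; its common value is \<open>k\<close>.\<close>

lemma (in inner_form) billiard_form_circle_iff:
  assumes nd: "nondegenerate P Q R"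
  shows "billiard_3_periodic (form_circle B c 1) P Q R \<longleftrightarrow>
    {P, Q, R} \<subseteq> form_circle B c 1 \<and> (\<exists>k>0. form_on_sides B k P Q R)"
proof (cases "{P, Q, R} \<subseteq> form_circle B c 1")
  case True
  then have E: "P \<in> form_circle B c 1" "Q \<in> form_circle B c 1" "R \<in> form_circle B c 1"
    by auto
  let ?r = "\<lambda>x. B x x / norm x"
  note ne = nondegenerate_neq[OF nd]
  have "billiard_3_periodic (form_circle B c 1) P Q R \<longleftrightarrow>
      ?r (P - R) = ?r (Q - P) \<and> ?r (Q - P) = ?r (R - Q) \<and> ?r (R - Q) = ?r (P - R)"
    unfolding billiard_3_periodic_def
      bisecting_normal_iff[OF nd E(1,2,3)]
      bisecting_normal_iff[OF nondegenerate_rotate[OF nd] E(2,3,1)]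
      bisecting_normal_iff[OF nondegenerate_rotate[OF nondegenerate_rotate[OF nd]] E(3,1,2)]
    using E by blast
  also have "\<dots> \<longleftrightarrow> (\<exists>k. ?r (Q - P) = k \<and> ?r (R - Q) = k \<and> ?r (P - R) = k)"
    by auto
  also have "\<dots> \<longleftrightarrow> (\<exists>k. form_on_sides B k P Q R)"
    using ne by (auto simp: form_on_sides_def field_simps)
  also have "\<dots> \<longleftrightarrow> (\<exists>k>0. form_on_sides B k P Q R)"
    using pos[of "Q - P"] ne by (auto simp: form_on_sides_def zero_less_mult_iff)
  finally show ?thesis using True by blast
next
  case False
  then show ?thesis by (auto simp: billiard_3_periodic_def)
qed


section \<open>Circumcenters in an inner product\<close>

context inner_form
begin

text \<open>The right-hand side is the linear equation of the perpendicular bisector of \<open>P Q\<close>.\<close>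

lemma equidistant_iff:
  "B (x - P) (x - P) = B (x - Q) (x - Q) \<longleftrightarrow> B (x - P) (Q - P) = B (Q - P) (Q - P) / 2"
proof -
  have "B (x - Q) (x - Q) = B (x - P) (x - P) - 2 * B (x - P) (Q - P) + B (Q - P) (Q - P)"
    using sym[of P Q] sym[of x P] sym[of x Q] by (simp add: bilin_simps)
  then show ?thesis by auto
qed

lemma ex_prescribed_products:
  assumes "cross2 u v \<noteq> 0"
  obtains x where "B x u = h" "B x v = k"
proof -
  define f :: "real^2 \<Rightarrow> real^2" where "f = (\<lambda>x. vector [B x u, B x v])"
  have "linear f"
    by (rule linearI) (simp_all add: f_def vec_eq_iff forall_2 bilin_simps)
  moreover have "inj f"
    unfolding linear_injective_0[OF \<open>linear f\<close>]
    using orthogonal_imp_parallel[of _ u v] assms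
    by (auto simp: f_def vec_eq_iff forall_2)
  ultimately have "surj f" by (rule linear_injective_imp_surjective) (rule refl)
  then obtain x where "f x = vector [h, k]" by (metis surjD)
  then show ?thesis by (intro that[of x]) (auto simp: f_def vec_eq_iff forall_2)
qed

lemma ex_circumcenter:
  assumes "nondegenerate P Q R"
  obtains c \<rho> where "0 < \<rho>" "{P, Q, R} \<subseteq> form_circle B c \<rho>"
proof -
  obtain c where "B c (Q - P) = B (Q - P) (Q - P) / 2 + B P (Q - P)"
    and "B c (R - P) = B (R - P) (R - P) / 2 + B P (R - P)"
    using assms ex_prescribed_products unfolding nondegenerate_def by metis
  then have c: "B (c - P) (c - P) = B (c - Q) (c - Q)" "B (c - P) (c - P) = B (c - R) (c - R)"
    unfolding equidistant_iff by (simp_all only: bilinear_lsub[OF bilinear])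
  have flip: "B (x - y) (x - y) = B (y - x) (y - x)" for x y by (simp add: bilin_simps)
  have "P \<noteq> c \<or> Q \<noteq> c" using nondegenerate_neq[OF assms] by auto
  then have "0 < B (c - P) (c - P)" using pos[of "c - P"] pos[of "c - Q"] c by auto
  moreover have "{P, Q, R} \<subseteq> form_circle B c (B (c - P) (c - P))"
    using c by (simp add: form_circle_def flip[of _ c])
  ultimately show ?thesis by (rule that)
qed

lemma eq_if_side_products_eq:
  assumes "nondegenerate P Q R"
    and "B (x - P) (Q - P) = B (y - P) (Q - P)" "B (x - Q) (R - Q) = B (y - Q) (R - Q)"
  shows "x = y"
proof (rule ccontr)
  assume "x \<noteq> y"
  have "B (x - y) (Q - P) = 0" "B (x - y) (R - Q) = 0"
    using assms(2,3) by (simp_all add: bilin_simps)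
  then have "cross2 (Q - P) (R - Q) = 0"
    using \<open>x \<noteq> y\<close> by (auto intro: orthogonal_imp_parallel)
  with assms(1) show False by (simp add: nondegenerate_def cross2_def algebra_simps)
qed

lemma form_circle_chord_product:
  assumes "P \<in> form_circle B c \<rho>" "Q \<in> form_circle B c \<rho>"
  shows "B (c - P) (Q - P) = B (Q - P) (Q - P) / 2"
  using chord_form[OF assms] by (simp add: bilin_simps)

end

section \<open>Existence and uniqueness of the form\<close>

lemma inner_form_scale:
  assumes "inner_form B" "0 < s"
  shows "inner_form (\<lambda>x y. s * B x y)"
proof -
  interpret inner_form B by fact
  show ?thesis
    using assms(2) by unfold_locales
      (auto simp: bilinear_def bilin_simps algebra_simps pos sym intro!: linearI)
qed

lemma form_circle_scale:
  assumes "0 < s"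
  shows "form_circle (\<lambda>x y. s * B x y) c \<rho> = form_circle B c (\<rho> / s)"
  using assms by (auto simp: form_circle_def field_simps)

text \<open>By polarization the values on the three sides determine the Gram matrix of two of them, and these
  two form a basis.\<close>

lemma form_on_sides_unique:
  assumes nd: "nondegenerate P Q R"
    and "inner_form B" "form_on_sides B k P Q R"
    and "inner_form B'" "form_on_sides B' 1 P Q R"
  shows "B x y = k * B' x y"
proof -
  interpret B: inner_form B by fact
  interpret B': inner_form B' by fact
  define u v where "u = Q - P" and "v = R - P"
  have uv: "cross2 u v \<noteq> 0" using nd by (simp add: nondegenerate_def u_def v_def)
  have sides: "R - Q = v - u" "P - R = - v" by (simp_all add: u_def v_def)
  have eq: "B u u = k * B' u u" "B v v = k * B' v v" "B (v - u) (v - u) = k * B' (v - u) (v - u)"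
    using assms(3,5) unfolding form_on_sides_def sides u_def[symmetric]
    by (simp_all add: B.bilinear B'.bilinear bilinear_lneg bilinear_rneg)
  then have "B u v = k * B' u v"
    using B.sym[of u v] B'.sym[of u v]
    by (simp add: B.bilin_simps B'.bilin_simps algebra_simps)
  moreover obtain s t where "x = s *\<^sub>R u + t *\<^sub>R v" by (rule cross2_basis[OF uv])
  moreover obtain s' t' where "y = s' *\<^sub>R u + t' *\<^sub>R v" by (rule cross2_basis[OF uv])
  ultimately show ?thesis
    using eq(1,2) B.sym[of v u] B'.sym[of v u]
    by (simp add: B.bilin_simps B'.bilin_simps algebra_simps)
qed

lemma ex_form_with_gram_matrix:
  assumes uv: "cross2 u v \<noteq> 0" and "0 < p" and det: "m\<^sup>2 < p * q"
  obtains B where "inner_form B" "B u u = p" "B u v = m" "B v v = q"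
proof -
  define D where "D = cross2 u v"
  define s where "s = (\<lambda>x. cross2 x v / D)"
  define t where "t = (\<lambda>x. cross2 u x / D)"
  define B where "B = (\<lambda>x y. p * (s x * s y) + m * (s x * t y + t x * s y) + q * (t x * t y))"
  have lin: "s (x + y) = s x + s y" "t (x + y) = t x + t y"
    "s (a *\<^sub>R x) = a * s x" "t (a *\<^sub>R x) = a * t x" for x y a
    by (simp_all add: s_def t_def cross2_def algebra_simps flip: add_divide_distrib diff_divide_distrib)
  have st: "x = s x *\<^sub>R u + t x *\<^sub>R v" for x
  proof -
    have "x = (1 / D) *\<^sub>R (D *\<^sub>R x)" using uv by (simp add: D_def)
    then show ?thesis unfolding D_def cross2_expand[of u v x]
      by (simp add: scaleR_add_right s_def t_def D_def)
  qed
  have "inner_form B"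
  proof
    show "bilinear B" unfolding bilinear_def B_def
      by (auto intro!: linearI simp: lin algebra_simps)
    show "B x y = B y x" for x y by (simp add: B_def algebra_simps)
    fix x :: "real^2" assume "x \<noteq> 0"
    then have "s x \<noteq> 0 \<or> t x \<noteq> 0" using st[of x] by auto
    have "p * B x x = (p * s x + m * t x)\<^sup>2 + (p * q - m\<^sup>2) * (t x)\<^sup>2"
      by (simp add: B_def power2_eq_square algebra_simps)
    also have "\<dots> > 0"
    proof (cases "t x = 0")
      case True
      then show ?thesis using \<open>s x \<noteq> 0 \<or> t x \<noteq> 0\<close> \<open>0 < p\<close> by simp
    next
      case False
      then show ?thesis using det by (intro add_nonneg_pos) simp_all
    qed
    finally show "0 < B x x" using \<open>0 < p\<close> by (simp add: zero_less_mult_iff)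
  qed
  moreover have "s u = 1" "t u = 0" "s v = 0" "t v = 1"
    using uv by (simp_all add: s_def t_def D_def cross2_self)
  then have "B u u = p" "B u v = m" "B v v = q" by (simp_all add: B_def)
  ultimately show ?thesis by (rule that)
qed

text \<open>Writing \<open>u\<close> and \<open>v\<close> for the sides from \<open>P\<close> to \<open>Q\<close> and to \<open>R\<close>, the length \<open>a\<close> of \<open>v - u\<close> prescribes the mixed
  entry \<open>(b + c - a) / 2\<close>.  The form is positive definite because square roots of the sides of a
  triangle again satisfy the strict triangle inequality; in polynomial form, the Gram determinant is positive.\<close>

lemma ex_side_length_form:
  assumes nd: "nondegenerate P Q R"
  obtains B where "inner_form B" "form_on_sides B 1 P Q R"
proof -
  define a b c where "a = norm (R - Q)" and "b = norm (P - R)" and "c = norm (Q - P)"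
  have tri: "b < c + a" "c < a + b" "a < b + c"
    using strict_triangle_inequalities[OF nd] by (simp_all add: a_def b_def c_def)
  have pos: "0 < a" "0 < b" "0 < c"
    using nondegenerate_neq[OF nd] by (simp_all add: a_def b_def c_def)
  define m where "m = (b + c - a) / 2"
  have "4 * (c * b - m\<^sup>2) = a * (b + c - a) + b * (c + a - b) + c * (a + b - c)"
    by (simp add: m_def power2_eq_square field_simps)
  moreover have "\<dots> > 0" using tri pos by (intro add_pos_pos mult_pos_pos) simp_all
  ultimately have "m\<^sup>2 < c * b" by simp
  with nd pos obtain B where B: "inner_form B"
    and uv: "B (Q - P) (Q - P) = c" "B (Q - P) (R - P) = m" "B (R - P) (R - P) = b"
    unfolding nondegenerate_def by (metis ex_form_with_gram_matrix)
  interpret inner_form B by fact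
  have "B (P - R) (P - R) = B (R - P) (R - P)" by (simp add: bilin_simps)
  moreover have "B (R - Q) (R - Q) = B (R - P) (R - P) - 2 * B (Q - P) (R - P) + B (Q - P) (Q - P)"
    using sym[of P Q] sym[of R P] sym[of R Q] by (simp add: bilin_simps)
  ultimately have "form_on_sides B 1 P Q R"
    unfolding form_on_sides_def by (simp add: uv m_def a_def b_def c_def field_simps)
  with B show ?thesis by (rule that)
qed


section \<open>Excenters\<close>

lemma tangent_line_iff:
  assumes "X \<noteq> Y" "0 < r"
  shows "sphere J r \<inter> affine hull {X, Y} = {D} \<longleftrightarrow>
    (\<exists>t. D = X + t *\<^sub>R (Y - X) \<and> (J - D) \<bullet> (Y - X) = 0 \<and> norm (J - D) = r)"
proof
  define l where "l = Y - X"
  have l: "l \<bullet> l > 0" using assms(1) by (simp add: l_def)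
  {
    assume S: "sphere J r \<inter> affine hull {X, Y} = {D}"
    then have "D \<in> affine hull {X, Y}" and r: "norm (J - D) = r" by (auto simp: dist_norm)
    then obtain t where D: "D = X + t *\<^sub>R l" by (auto simp: affine_hull_2_alt l_def)
    \<comment> \<open>The reflection of \<open>D\<close> in the foot of the perpendicular from \<open>J\<close> lies on both the line and the circle.\<close>
    define s where "s = 2 * ((J - D) \<bullet> l) / (l \<bullet> l)"
    have s: "s * (l \<bullet> l) = 2 * ((J - D) \<bullet> l)" using l by (simp add: s_def)
    have "J - (D + s *\<^sub>R l) = (J - D) - s *\<^sub>R l" by simp
    then have "(norm (J - (D + s *\<^sub>R l)))\<^sup>2
        = (J - D) \<bullet> (J - D) - 2 * s * ((J - D) \<bullet> l) + s * (s * (l \<bullet> l))"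
      by (simp add: power2_norm_eq_inner inner_diff_left inner_diff_right inner_commute algebra_simps)
    also have "\<dots> = r\<^sup>2" unfolding s r[symmetric] power2_norm_eq_inner by simp
    finally have "D + s *\<^sub>R l \<in> sphere J r" using assms(2) by (simp add: dist_norm)
    moreover have "D + s *\<^sub>R l = X + (t + s) *\<^sub>R l" by (simp add: D algebra_simps)
    then have "D + s *\<^sub>R l \<in> affine hull {X, Y}" unfolding affine_hull_2_alt l_def by blast
    ultimately have "D + s *\<^sub>R l = D" using S by blast
    then have "s = 0" using l by auto
    then have "(J - D) \<bullet> l = 0" using s by simp
    with D r show "\<exists>t. D = X + t *\<^sub>R (Y - X) \<and> (J - D) \<bullet> (Y - X) = 0 \<and> norm (J - D) = r"
      unfolding l_def by blast
  next
    assume "\<exists>t. D = X + t *\<^sub>R (Y - X) \<and> (J - D) \<bullet> (Y - X) = 0 \<and> norm (J - D) = r"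
    then obtain t where D: "D = X + t *\<^sub>R l" and orth: "(J - D) \<bullet> l = 0" and r: "norm (J - D) = r"
      unfolding l_def by blast
    have "y = D" if y: "y \<in> sphere J r" "y \<in> affine hull {X, Y}" for y
    proof -
      obtain t' where "y = X + t' *\<^sub>R l" using y(2) by (auto simp: affine_hull_2_alt l_def)
      then have yD: "y = D + (t' - t) *\<^sub>R l" by (simp add: D algebra_simps)
      have "(norm (w - s *\<^sub>R l))\<^sup>2 = (norm w)\<^sup>2 + (s * s) * (l \<bullet> l)" if "w \<bullet> l = 0" for w s
        using that by (simp add: power2_norm_eq_inner inner_diff_left inner_diff_right inner_commute)
      moreover have Jy: "J - y = (J - D) - (t' - t) *\<^sub>R l" by (simp add: yD)
      ultimately have "(norm (J - y))\<^sup>2 = (norm (J - D))\<^sup>2 + ((t' - t) * (t' - t)) * (l \<bullet> l)"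
        using orth unfolding Jy by blast
      moreover have "norm (J - y) = r" using y(1) by (simp add: dist_norm)
      ultimately have "t' = t" using l r by simp
      then show ?thesis by (simp add: yD)
    qed
    moreover have "D \<in> affine hull {X, Y}" unfolding affine_hull_2_alt D l_def by blast
    moreover have "D \<in> sphere J r" using r by (simp add: dist_norm)
    ultimately show "sphere J r \<inter> affine hull {X, Y} = {D}" by blast
  }
qed

lemma line_point_in_segment_iff:
  fixes X Y :: "'a :: real_vector"
  assumes "X \<noteq> Y"
  shows "X + t *\<^sub>R (Y - X) \<in> open_segment X Y \<longleftrightarrow> 0 < t \<and> t < 1"
    and "X + t *\<^sub>R (Y - X) \<in> closed_segment X Y \<longleftrightarrow> 0 \<le> t \<and> t \<le> 1"
proof -
  have eq: "(1 - s) *\<^sub>R X + s *\<^sub>R Y = X + s *\<^sub>R (Y - X)" for s by (simp add: algebra_simps)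
  show "X + t *\<^sub>R (Y - X) \<in> open_segment X Y \<longleftrightarrow> 0 < t \<and> t < 1"
    and "X + t *\<^sub>R (Y - X) \<in> closed_segment X Y \<longleftrightarrow> 0 \<le> t \<and> t \<le> 1"
    using assms by (auto simp: in_segment eq)
qed

lemma tangent_length:
  fixes X Y J :: "'a :: real_inner"
  assumes "(J - (X + t *\<^sub>R (Y - X))) \<bullet> (Y - X) = 0"
  shows "(norm (J - X))\<^sup>2 = (norm (J - (X + t *\<^sub>R (Y - X))))\<^sup>2 + (t * norm (Y - X))\<^sup>2"
    and "(norm (J - Y))\<^sup>2 = (norm (J - (X + t *\<^sub>R (Y - X))))\<^sup>2 + (norm (Y - X) - t * norm (Y - X))\<^sup>2"
proof -
  define D l where "D = X + t *\<^sub>R (Y - X)" and "l = Y - X"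
  have orth: "(J - D) \<bullet> l = 0" using assms by (simp add: D_def l_def)
  have *: "(norm (J - D + s *\<^sub>R l))\<^sup>2 = (norm (J - D))\<^sup>2 + (s * norm l)\<^sup>2" for s
    using norm_add_Pythagorean[of "J - D" "s *\<^sub>R l"] orth
    by (simp add: orthogonal_def power_mult_distrib)
  have XY: "J - X = J - D + t *\<^sub>R l" "J - Y = J - D + (t - 1) *\<^sub>R l"
    by (simp_all add: D_def l_def algebra_simps)
  have "(norm (J - X))\<^sup>2 = (norm (J - D))\<^sup>2 + (t * norm l)\<^sup>2"
    "(norm (J - Y))\<^sup>2 = (norm (J - D))\<^sup>2 + ((t - 1) * norm l)\<^sup>2"
    unfolding XY * by (rule refl)+
  moreover have "((t - 1) * norm l)\<^sup>2 = (norm l - t * norm l)\<^sup>2"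
    by (simp add: power2_eq_square algebra_simps)
  ultimately show "(norm (J - X))\<^sup>2 = (norm (J - (X + t *\<^sub>R (Y - X))))\<^sup>2 + (t * norm (Y - X))\<^sup>2"
    "(norm (J - Y))\<^sup>2 = (norm (J - (X + t *\<^sub>R (Y - X))))\<^sup>2 + (norm (Y - X) - t * norm (Y - X))\<^sup>2"
    unfolding D_def l_def by simp_all
qed

text \<open>The two tangent segments from a vertex to an excircle have equal length.  With the points of contact
  in the required positions on the side lines, these equalities leave one solution for the three contact points, and the two
  products locate the excenter relative to the sides at \<open>Q\<close>.\<close>

lemma is_excenter_imp_products:
  assumes nd: "nondegenerate P Q R" and J: "is_excenter P Q R J"
  defines "a \<equiv> norm (R - Q)" and "b \<equiv> norm (P - R)" and "c \<equiv> norm (Q - P)"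
  shows "(J - Q) \<bullet> (R - Q) = a * (a + b - c) / 2"
    and "(J - Q) \<bullet> (Q - P) = c * (a + b - c) / 2"
proof -
  note ne = nondegenerate_neq[OF nd]
  have abc: "0 < a" "0 < b" "0 < c" using ne by (simp_all add: a_def b_def c_def)
  from J obtain r D1 D2 D3 where "0 < r"
    and D1: "D1 \<in> open_segment Q R" "sphere J r \<inter> affine hull {Q, R} = {D1}"
    and D2: "D2 \<notin> closed_segment R P" "sphere J r \<inter> affine hull {R, P} = {D2}"
    and D3: "D3 \<notin> closed_segment P Q" "sphere J r \<inter> affine hull {P, Q} = {D3}"
    unfolding is_excenter_def by blast
  obtain t where t: "D1 = Q + t *\<^sub>R (R - Q)" "(J - D1) \<bullet> (R - Q) = 0" "norm (J - D1) = r"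
    using D1(2) unfolding tangent_line_iff[OF ne(2) \<open>0 < r\<close>] by blast
  obtain u where u: "D2 = R + u *\<^sub>R (P - R)" "(J - D2) \<bullet> (P - R) = 0" "norm (J - D2) = r"
    using D2(2) unfolding tangent_line_iff[OF ne(3) \<open>0 < r\<close>] by blast
  obtain v where v: "D3 = P + v *\<^sub>R (Q - P)" "(J - D3) \<bullet> (Q - P) = 0" "norm (J - D3) = r"
    using D3(2) unfolding tangent_line_iff[OF ne(1) \<open>0 < r\<close>] by blast
  \<comment> \<open>Signed distances of the contact points from the start of the three oriented sides.\<close>
  define x y z where "x = t * a" and "y = u * b" and "z = v * c"
  have "(norm (J - Q))\<^sup>2 = r\<^sup>2 + x\<^sup>2" "(norm (J - R))\<^sup>2 = r\<^sup>2 + (a - x)\<^sup>2"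
    using tangent_length[of J Q t R] t unfolding x_def a_def by auto
  moreover have "(norm (J - R))\<^sup>2 = r\<^sup>2 + y\<^sup>2" "(norm (J - P))\<^sup>2 = r\<^sup>2 + (b - y)\<^sup>2"
    using tangent_length[of J R u P] u unfolding y_def b_def by auto
  moreover have "(norm (J - P))\<^sup>2 = r\<^sup>2 + z\<^sup>2" "(norm (J - Q))\<^sup>2 = r\<^sup>2 + (c - z)\<^sup>2"
    using tangent_length[of J P v Q] v unfolding z_def c_def by auto
  ultimately have "x\<^sup>2 = (c - z)\<^sup>2" "(a - x)\<^sup>2 = y\<^sup>2" "(b - y)\<^sup>2 = z\<^sup>2" by simp_all
  then have lens: "\<bar>x\<bar> = \<bar>c - z\<bar>" "\<bar>a - x\<bar> = \<bar>y\<bar>" "\<bar>b - y\<bar> = \<bar>z\<bar>"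
    by (simp_all add: power2_eq_iff abs_eq_iff)
  have "0 < t" "t < 1" using D1(1) unfolding t line_point_in_segment_iff[OF ne(2)] by auto
  then have x: "0 < x" "x < a" using abc by (simp_all add: x_def)
  have "u < 0 \<or> 1 < u" using D2(1) unfolding u line_point_in_segment_iff[OF ne(3)] by auto
  then have y: "y < 0 \<or> b < y" using abc by (simp add: y_def mult_less_0_iff)
  have "v < 0 \<or> 1 < v" using D3(1) unfolding v line_point_in_segment_iff[OF ne(1)] by auto
  then have z: "z < 0 \<or> c < z" using abc by (simp add: z_def mult_less_0_iff)
  have tri: "a < b + c" "b < c + a" "c < a + b"
    using strict_triangle_inequalities[OF nd] by (simp_all add: a_def b_def c_def)
  have xz: "x = (a + b - c) / 2" "z - c = (a + b - c) / 2"
    using lens x y z tri by (auto simp: abs_if split: if_splits)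
  have "(J - Q) \<bullet> (R - Q) = (J - D1) \<bullet> (R - Q) + t * (norm (R - Q))\<^sup>2"
    unfolding t(1) power2_norm_eq_inner by (simp add: inner_diff_left inner_add_left)
  also have "\<dots> = a * x" unfolding t(2) x_def a_def power2_eq_square by simp
  finally show "(J - Q) \<bullet> (R - Q) = a * (a + b - c) / 2" using xz by simp
  have "(J - Q) \<bullet> (Q - P) = (J - D3) \<bullet> (Q - P) + (v - 1) * (norm (Q - P))\<^sup>2"
    unfolding v(1) power2_norm_eq_inner
    by (simp add: inner_diff_left inner_diff_right inner_add_left algebra_simps)
  also have "\<dots> = c * (z - c)" unfolding v(2) z_def c_def power2_eq_square by (simp add: algebra_simps)
  finally show "(J - Q) \<bullet> (Q - P) = c * (a + b - c) / 2" using xz by simp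
qed

text \<open>The point with barycentric coordinates \<open>- a : b : c\<close>, written relative to \<open>Q\<close>, where \<open>a\<close>, \<open>b\<close>,
  \<open>c\<close> are the lengths of the sides opposite \<open>P\<close>, \<open>Q\<close>, \<open>R\<close>.\<close>

definition excenter_point :: "real^2 \<Rightarrow> real^2 \<Rightarrow> real^2 \<Rightarrow> real^2" where
  "excenter_point P Q R =
     Q + (1 / (norm (P - R) + norm (Q - P) - norm (R - Q))) *\<^sub>R
       (norm (Q - P) *\<^sub>R (R - Q) + norm (R - Q) *\<^sub>R (Q - P))"

lemma excenter_point_off_side:
  assumes nd: "nondegenerate P Q R"
  shows "cross2 (R - Q) (excenter_point P Q R - Q) \<noteq> 0"
proof -
  define k where "k = norm (P - R) + norm (Q - P) - norm (R - Q)"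
  have "k > 0"
    using strict_triangle_inequalities(1)[OF nd] by (simp add: k_def)
  have "cross2 (R - Q) (excenter_point P Q R - Q)
      = (1 / k) * (norm (R - Q) * cross2 (R - Q) (Q - P))"
    unfolding excenter_point_def k_def[symmetric]
    by (simp add: cross2_scaleR_right) (simp add: cross2_def algebra_simps)
  moreover have "cross2 (R - Q) (Q - P) = - cross2 (Q - P) (R - P)"
    by (simp add: cross2_def algebra_simps)
  ultimately show ?thesis
    using \<open>k > 0\<close> nd nondegenerate_neq[OF nd] by (simp add: nondegenerate_def)
qed

lemma excenter_point_products:
  assumes nd: "nondegenerate P Q R"
  defines "a \<equiv> norm (R - Q)" and "b \<equiv> norm (P - R)" and "c \<equiv> norm (Q - P)"
  shows "(excenter_point P Q R - Q) \<bullet> (R - Q) = a * (a + b - c) / 2"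
    and "(excenter_point P Q R - Q) \<bullet> (Q - P) = c * (a + b - c) / 2"
proof -
  define e f where "e = R - Q" and "f = Q - P"
  have k: "b + c - a > 0"
    using strict_triangle_inequalities(1)[OF nd] by (simp add: a_def b_def c_def)
  have PR: "P - R = - (e + f)" by (simp add: e_def f_def)
  have "b = norm (e + f)" unfolding b_def PR by (rule norm_minus_cancel)
  then have "b\<^sup>2 = a\<^sup>2 + c\<^sup>2 + 2 * (e \<bullet> f)"
    unfolding a_def c_def e_def[symmetric] f_def[symmetric] power2_norm_eq_inner
    by (simp add: power2_norm_eq_inner inner_add_left inner_add_right inner_commute)
  then have ef: "e \<bullet> f = (b\<^sup>2 - a\<^sup>2 - c\<^sup>2) / 2" by simp
  have ee: "e \<bullet> e = a\<^sup>2" "f \<bullet> f = c\<^sup>2"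
    by (simp_all add: a_def c_def e_def f_def power2_norm_eq_inner)
  have J: "excenter_point P Q R - Q = (1 / (b + c - a)) *\<^sub>R (c *\<^sub>R e + a *\<^sub>R f)"
    by (simp add: excenter_point_def a_def b_def c_def e_def f_def)
  have *: "(c *\<^sub>R e + a *\<^sub>R f) \<bullet> e = (b + c - a) * (a * (a + b - c) / 2)"
    "(c *\<^sub>R e + a *\<^sub>R f) \<bullet> f = (b + c - a) * (c * (a + b - c) / 2)"
    by (simp_all add: inner_add_left ee ef inner_commute[of f e] power2_eq_square field_simps)
  show "(excenter_point P Q R - Q) \<bullet> (R - Q) = a * (a + b - c) / 2"
    "(excenter_point P Q R - Q) \<bullet> (Q - P) = c * (a + b - c) / 2"
    unfolding J e_def[symmetric] f_def[symmetric] inner_scaleR_left * using k by simp_all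
qed

text \<open>The points of contact are at the known tangent lengths from the vertices.  Orthogonality follows from
  the products above, and the distances from the center agree because adjacent contact points
  are equally far from their common vertex.\<close>

lemma is_excenter_excenter_point:
  assumes nd: "nondegenerate P Q R"
  shows "is_excenter P Q R (excenter_point P Q R)"
proof -
  define a b c where "a = norm (R - Q)" and "b = norm (P - R)" and "c = norm (Q - P)"
  define J where "J = excenter_point P Q R"
  note ne = nondegenerate_neq[OF nd]
  have abc: "0 < a" "0 < b" "0 < c" using ne by (simp_all add: a_def b_def c_def)
  have tri: "a < b + c" "b < c + a" "c < a + b"
    using strict_triangle_inequalities[OF nd] by (simp_all add: a_def b_def c_def)
  have JQ: "(J - Q) \<bullet> (R - Q) = a * (a + b - c) / 2" "(J - Q) \<bullet> (Q - P) = c * (a + b - c) / 2"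
    using excenter_point_products[OF nd] by (simp_all add: J_def a_def b_def c_def)
  have sq: "(R - Q) \<bullet> (R - Q) = a\<^sup>2" "(P - R) \<bullet> (P - R) = b\<^sup>2" "(Q - P) \<bullet> (Q - P) = c\<^sup>2"
    by (simp_all add: a_def b_def c_def power2_norm_eq_inner)
  have PR: "P - R = - ((R - Q) + (Q - P))" by simp
  have RQ_QP: "(R - Q) \<bullet> (Q - P) = (b\<^sup>2 - a\<^sup>2 - c\<^sup>2) / 2"
    using sq(2) unfolding PR inner_minus_left inner_minus_right
    by (simp only: inner_add_left inner_add_right inner_commute[of "Q - P" "R - Q"] sq) simp
  have "(J - R) \<bullet> (P - R) = ((J - Q) - (R - Q)) \<bullet> (- ((R - Q) + (Q - P)))" by simp
  also have "\<dots> = - (b * (c + a - b) / 2)"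
    unfolding inner_minus_right inner_add_right inner_diff_left[of "J - Q" "R - Q"] JQ sq RQ_QP
    by (simp add: power2_eq_square field_simps)
  finally have JR: "(J - R) \<bullet> (P - R) = - (b * (c + a - b) / 2)" .
  have JP: "(J - P) \<bullet> (Q - P) = c * (a + b + c) / 2"
  proof -
    have "(J - P) \<bullet> (Q - P) = (J - Q) \<bullet> (Q - P) + (Q - P) \<bullet> (Q - P)"
      by (simp add: inner_diff_left)
    then show ?thesis unfolding JQ sq by (simp add: power2_eq_square field_simps)
  qed
  define t u v where "t = (a + b - c) / (2 * a)" and "u = - (c + a - b) / (2 * b)"
    and "v = (a + b + c) / (2 * c)"
  define D1 D2 D3 where "D1 = Q + t *\<^sub>R (R - Q)" and "D2 = R + u *\<^sub>R (P - R)"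
    and "D3 = P + v *\<^sub>R (Q - P)"
  have tuv: "t * a = (a + b - c) / 2" "u * b = - (c + a - b) / 2" "v * c = (a + b + c) / 2"
    using abc by (simp_all add: t_def u_def v_def)
  have orth: "(J - D1) \<bullet> (R - Q) = 0" "(J - D2) \<bullet> (P - R) = 0" "(J - D3) \<bullet> (Q - P) = 0"
  proof -
    have *: "(J - (X + s *\<^sub>R l)) \<bullet> l = (J - X) \<bullet> l - s * (l \<bullet> l)" for X s l
      by (simp add: inner_diff_left inner_add_left)
    show "(J - D1) \<bullet> (R - Q) = 0" "(J - D2) \<bullet> (P - R) = 0" "(J - D3) \<bullet> (Q - P) = 0"
      unfolding D1_def D2_def D3_def * JQ JR JP sq power2_eq_square mult.assoc[symmetric] tuv
      by (simp_all add: field_simps)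
  qed
  define r where "r = norm (J - D1)"
  note len1 = tangent_length[OF orth(1)[unfolded D1_def], folded D1_def a_def, unfolded tuv]
  note len2 = tangent_length[OF orth(2)[unfolded D2_def], folded D2_def b_def, unfolded tuv]
  note len3 = tangent_length[OF orth(3)[unfolded D3_def], folded D3_def c_def, unfolded tuv]
  have "(norm (J - D2))\<^sup>2 = r\<^sup>2"
    using len1(2) len2(1) by (simp add: r_def power2_eq_square field_simps)
  moreover have "(norm (J - D3))\<^sup>2 = r\<^sup>2"
    using len1(1) len3(2) by (simp add: r_def power2_eq_square field_simps)
  ultimately have r: "norm (J - D2) = r" "norm (J - D3) = r" by (simp_all add: r_def)
  have "J \<noteq> D1"
  proof
    assume "J = D1"
    then have "cross2 (R - Q) (J - Q) = 0" by (simp add: D1_def cross2_scaleR_right cross2_self)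
    with excenter_point_off_side[OF nd] show False by (simp add: J_def)
  qed
  then have "0 < r" by (simp add: r_def)
  have "D1 \<in> open_segment Q R"
    unfolding D1_def line_point_in_segment_iff[OF ne(2)] using tri abc by (simp add: t_def)
  moreover have "D2 \<notin> closed_segment R P"
    unfolding D2_def line_point_in_segment_iff[OF ne(3)] using tri abc
    by (simp add: u_def field_simps)
  moreover have "D3 \<notin> closed_segment P Q"
    unfolding D3_def line_point_in_segment_iff[OF ne(1)] using tri abc
    by (simp add: v_def field_simps)
  moreover have "sphere J r \<inter> affine hull {Q, R} = {D1}"
    unfolding tangent_line_iff[OF ne(2) \<open>0 < r\<close>] using orth(1) D1_def r_def by blast
  moreover have "sphere J r \<inter> affine hull {R, P} = {D2}"
    unfolding tangent_line_iff[OF ne(3) \<open>0 < r\<close>] using orth(2) D2_def r by blast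
  moreover have "sphere J r \<inter> affine hull {P, Q} = {D3}"
    unfolding tangent_line_iff[OF ne(1) \<open>0 < r\<close>] using orth(3) D3_def r by blast
  ultimately show ?thesis unfolding is_excenter_def J_def using \<open>0 < r\<close> by blast
qed

lemma excenter_eq:
  assumes nd: "nondegenerate P Q R"
  shows "excenter P Q R = excenter_point P Q R"
  unfolding excenter_def
proof (rule the_equality)
  show "is_excenter P Q R (excenter_point P Q R)" by (rule is_excenter_excenter_point[OF nd])
  fix J assume J: "is_excenter P Q R J"
  have "(J - Q) \<bullet> (R - Q) = (excenter_point P Q R - Q) \<bullet> (R - Q)"
    "(J - Q) \<bullet> (Q - P) = (excenter_point P Q R - Q) \<bullet> (Q - P)"
    unfolding is_excenter_imp_products[OF nd J] excenter_point_products[OF nd] by (rule refl)+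
  then show "J = excenter_point P Q R"
    by (intro euclidean.eq_if_side_products_eq[OF nd]) (simp_all add: inner_diff_left)
qed

section \<open>The Mittenpunkt as a circumcenter\<close>

text \<open>The excenter is equidistant from \<open>Q\<close> and \<open>R\<close> for the form that measures the sides by their lengths:
  with \<open>e = R - Q\<close> and \<open>f = Q - P\<close>, the values \<open>B e e = a\<close> and \<open>B f e = (b - a - c) / 2\<close> give
  \<open>B (c e + a f) e = (b + c - a) a / 2\<close>.  So the line through the excenter and the midpoint is the
  perpendicular bisector of the side \<open>Q R\<close> in that inner product.\<close>

lemma excenter_median_line:
  assumes nd: "nondegenerate P Q R" and B: "inner_form B" "form_on_sides B 1 P Q R"
  shows "affine hull {excenter P Q R, midpoint Q R} =
    {x. B (x - Q) (R - Q) = B (R - Q) (R - Q) / 2}"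
proof -
  interpret inner_form B by fact
  define a b c where "a = norm (R - Q)" and "b = norm (P - R)" and "c = norm (Q - P)"
  define e f where "e = R - Q" and "f = Q - P"
  have k: "b + c - a > 0"
    using strict_triangle_inequalities(1)[OF nd] by (simp add: a_def b_def c_def)
  have ee: "B e e = a" "B f f = c"
    using B(2) by (simp_all add: form_on_sides_def a_def c_def e_def f_def)
  have PR: "P - R = - (e + f)" by (simp add: e_def f_def)
  have "b = B (P - R) (P - R)" using B(2) by (simp add: form_on_sides_def b_def)
  also have "\<dots> = a + c + 2 * B f e"
    unfolding PR using sym[of e f] by (simp add: bilin_simps ee)
  finally have fe: "B f e = (b - a - c) / 2" by simp
  have J: "excenter_point P Q R - Q = (1 / (b + c - a)) *\<^sub>R (c *\<^sub>R e + a *\<^sub>R f)"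
    by (simp add: excenter_point_def a_def b_def c_def e_def f_def)
  have JB: "B (excenter_point P Q R - Q) (R - Q) = B (R - Q) (R - Q) / 2"
  proof -
    have "B (c *\<^sub>R e + a *\<^sub>R f) e = (b + c - a) * (a / 2)"
      by (simp add: bilin_simps ee fe field_simps)
    then show ?thesis
      unfolding J e_def[symmetric] bilinear_lmul[OF bilinear] ee using k by simp
  qed
  have M: "midpoint Q R - Q = (1 / 2) *\<^sub>R (R - Q)"
    by (simp add: midpoint_def vec_eq_iff field_simps)
  then have MB: "B (midpoint Q R - Q) (R - Q) = B (R - Q) (R - Q) / 2"
    by (simp add: bilinear_lmul[OF bilinear])
  have "cross2 (R - Q) (midpoint Q R - Q) = 0"
    unfolding M by (simp add: cross2_scaleR_right cross2_self)
  then have "excenter_point P Q R \<noteq> midpoint Q R"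
    using excenter_point_off_side[OF nd] by auto
  moreover have "R - Q \<noteq> 0" using nondegenerate_neq[OF nd] by simp
  ultimately show ?thesis unfolding excenter_eq[OF nd] by (intro line_eq JB MB)
qed

lemma mittenpunkt_eq_circumcenter:
  assumes nd: "nondegenerate P Q R" and B: "inner_form B" "form_on_sides B 1 P Q R"
    and c: "{P, Q, R} \<subseteq> form_circle B c \<rho>"
  shows "mittenpunkt P Q R = c"
proof -
  interpret inner_form B by fact
  note nd' = nondegenerate_rotate[OF nd] and B' = form_on_sides_rotate[OF B(2)]
  note lines = excenter_median_line[OF nd B] excenter_median_line[OF nd' B(1) B']
    excenter_median_line[OF nondegenerate_rotate[OF nd'] B(1) form_on_sides_rotate[OF B']]
  have bisectors: "B (c - Q) (R - Q) = B (R - Q) (R - Q) / 2"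
    "B (c - R) (P - R) = B (P - R) (P - R) / 2" "B (c - P) (Q - P) = B (Q - P) (Q - P) / 2"
    using c form_circle_chord_product by blast+
  show ?thesis
    unfolding mittenpunkt_def lines mem_Collect_eq
  proof (rule the_equality)
    fix x assume "B (x - Q) (R - Q) = B (R - Q) (R - Q) / 2 \<and>
      B (x - R) (P - R) = B (P - R) (P - R) / 2 \<and> B (x - P) (Q - P) = B (Q - P) (Q - P) / 2"
    then show "x = c" using bisectors by (intro eq_if_side_products_eq[OF nd]) simp_all
  qed (use bisectors in blast)
qed

section \<open>Uniqueness of the billiard ellipse and its center\<close>

theorem proposition1:
  fixes P1 P2 P3 :: "real^2"
  assumes "\<not> collinear {P1, P2, P3}"
  shows "(\<exists>!E. is_ellipse E \<and> billiard_3_periodic E P1 P2 P3) \<and>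
         (\<forall>E. is_ellipse E \<and> billiard_3_periodic E P1 P2 P3 \<longrightarrow>
              ellipse_center E = mittenpunkt P1 P2 P3)"
proof -
  have nd: "nondegenerate P1 P2 P3" using assms by (rule not_collinear_imp_nondegenerate)
  obtain B where B: "inner_form B" "form_on_sides B 1 P1 P2 P3"
    using ex_side_length_form[OF nd] .
  interpret inner_form B by fact
  obtain c \<rho> where "0 < \<rho>" and c: "{P1, P2, P3} \<subseteq> form_circle B c \<rho>"
    using ex_circumcenter[OF nd] .
  define E where "E = form_circle B c \<rho>"
  define B1 where "B1 = (\<lambda>x y. 1 / \<rho> * B x y)"
  have B1: "inner_form B1" unfolding B1_def using \<open>0 < \<rho>\<close> B(1) by (intro inner_form_scale) simp_all
  have E: "E = form_circle B1 c 1"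
    using form_circle_scale[of "1 / \<rho>" B c 1] \<open>0 < \<rho>\<close> by (simp add: E_def B1_def)
  have cent: "ellipse_centered_at E c" using ellipse_iff_form_circle E B1 by blast
  have "form_on_sides B1 (1 / \<rho>) P1 P2 P3" using B(2) by (simp add: form_on_sides_def B1_def)
  then have bil: "billiard_3_periodic E P1 P2 P3"
    using inner_form.billiard_form_circle_iff[OF B1 nd, of c] c \<open>0 < \<rho>\<close>
    unfolding E_def[symmetric] E[symmetric] by auto
  have uniq: "E' = E" if E': "is_ellipse E'" "billiard_3_periodic E' P1 P2 P3" for E'
  proof -
    obtain c' B' where B': "inner_form B'" and E'_eq: "E' = form_circle B' c' 1"
      using E'(1) unfolding is_ellipse_def ellipse_iff_form_circle by blast
    obtain k where on: "{P1, P2, P3} \<subseteq> form_circle B' c' 1" and "0 < k"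
      and k: "form_on_sides B' k P1 P2 P3"
      using E'(2) unfolding E'_eq inner_form.billiard_form_circle_iff[OF B' nd] by blast
    have "B' = (\<lambda>x y. k * B x y)"
      by (intro ext form_on_sides_unique[OF nd B' k B])
    then have E'_B: "form_circle B' c' 1 = form_circle B c' (1 / k)"
      using form_circle_scale[OF \<open>0 < k\<close>] by simp
    have on': "{P1, P2, P3} \<subseteq> form_circle B c' (1 / k)" using on unfolding E'_B .
    have "c' = c"
      using mittenpunkt_eq_circumcenter[OF nd B on'] mittenpunkt_eq_circumcenter[OF nd B c] by simp
    moreover have "1 / k = \<rho>" using on' c unfolding \<open>c' = c\<close> by (auto simp: form_circle_def)
    ultimately show ?thesis unfolding E'_eq E'_B E_def by simp
  qed
  have "is_ellipse E" using cent unfolding is_ellipse_def by blast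
  moreover have "ellipse_center E = mittenpunkt P1 P2 P3"
    using ellipse_center_eq[OF cent] mittenpunkt_eq_circumcenter[OF nd B c] by simp
  ultimately show ?thesis using bil uniq by blast
qed

end
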